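(* Let $T=\{1,\dots,m\}$, let $a_t\in\mathbb{R}^n$ ($t\in T$) and $c\in\mathbb{R}^n$ be fixed with $-c\in\mathrm{cone}\{a_t: t\in T\}$, and consider the linear programs $LP(b)$: minimize $\langle c,x\rangle$ subject to $x\in\mathcal{F}(b)$, $b\in\mathbb{R}^T$, with feasible set mapping $\mathcal{F}$, optimal solution mapping $\mathcal{S}$ and optimal value mapping $\mathcal{P}$ (see context). Let $(\overline{b},\overline{x})\in\mathrm{gph}\,\mathcal{S}$. Then $$\mathrm{lip}\,\mathcal{P}(\overline{b})=\mathrm{lip}\,\mathcal{E}_{\mathcal{P}}(\overline{b})=\|c\|_*\,\mathrm{lip}\,\mathcal{E}_{\mathcal{F}}(\overline{b},\overline{x}).$$
   Context: $\mathbb{R}^n$ carries an arbitrary norm with dual norm $\|\cdot\|_*$, $\mathbb{R}$ carries the absolute value, $\mathbb{R}^T$ carries the supremum norm. $\mathcal{F}(b):=\{x\in\mathbb{R}^n:\langle a_t,x\rangle\le b_t,\ t\in T\}$; $\mathcal{S}(b)$ is the set of optimal solutions of $LP(b)$; $\vartheta(b):=\inf\{\langle c,x\rangle: x\in\mathcal{F}(b)\}$; $\mathcal{P}:\mathbb{R}^T\rightrightarrows\mathbb{R}$ is given by $\mathcal{P}(b)=\{\vartheta(b)\}$ if $\mathcal{S}(b)\ne\emptyset$ and $\mathcal{P}(b)=\emptyset$ otherwise. $\mathrm{cone}$ denotes the convex conic hull. $\mathcal{E}_{\mathcal{P}}(b):=\mathcal{P}(b)+[0,\infty)$ and $\mathcal{E}_{\mathcal{F}}(b):=\mathcal{F}(b)+\{c\}^\circ$,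 where $\{c\}^\circ=\{u\in\mathbb{R}^n:\langle c,u\rangle\ge0\}$. $\mathrm{gph}\,\mathcal{M}=\{(y,z): z\in\mathcal{M}(y)\}$. For a set-valued mapping $\mathcal{M}$ between metric spaces and $(\overline{y},\overline{z})\in\mathrm{gph}\,\mathcal{M}$, the Lipschitz modulus $\mathrm{lip}\,\mathcal{M}(\overline{y},\overline{z})\in[0,\infty]$ is the infimum of all $\ell\ge0$ for which there are neighborhoods $U$ of $\overline{y}$ and $V$ of $\overline{z}$ with $d(z,\mathcal{M}(y'))\le\ell\,d(y,y')$ for all $y,y'\in U$ and $z\in V\cap\mathcal{M}(y)$ (with $d(z,\emptyset)=\infty$ and $\inf\emptyset=\infty$). $\mathrm{lip}\,\mathcal{P}(\overline{b})$ and $\mathrm{lip}\,\mathcal{E}_{\mathcal{P}}(\overline{b})$ mean $\mathrm{lip}\,\mathcal{P}(\overline{b},\vartheta(\overline{b}))$ and $\mathrm{lip}\,\mathcal{E}_{\mathcal{P}}(\overline{b},\vartheta(\overline{b}))$.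
   Formalization: If c = 0 and the Lipschitz modulus of the epigraphical feasible set mapping is infinite, the product on the right reads 0·∞, which the statement leaves undefined; it is read as ∞ (with 0·∞ = 0 the claim would fail). In all other cases it is the ordinary product. *)

theory Defs
  imports "HOL-Analysis.Analysis"
begin

section \<open>Metrics induced by norms, and dual norms\<close>

definition is_norm :: "('v::real_vector \<Rightarrow> real) \<Rightarrow> bool" where
  "is_norm N \<longleftrightarrow>
     (\<forall>x. N x = 0 \<longleftrightarrow> x = 0) \<and>
     (\<forall>r x. N (r *\<^sub>R x) = \<bar>r\<bar> * N x) \<and>
     (\<forall>x y. N (x + y) \<le> N x + N y)"

text \<open>The type constructor \<open>metric\<close> is only meaningful on arguments satisfying
  \<^const>\<open>Metric_space\<close>; the lemmas below show that this is the case for every norm.\<close>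

definition norm_metric :: "('v::real_vector \<Rightarrow> real) \<Rightarrow> 'v metric" where
  "norm_metric N = metric (UNIV, \<lambda>x y. N (x - y))"

lemma Metric_space_norm:
  assumes "is_norm N"
  shows "Metric_space UNIV (\<lambda>x y. N (x - y))"
proof -
  have z: "N x = 0 \<longleftrightarrow> x = 0" and s: "N (r *\<^sub>R x) = \<bar>r\<bar> * N x"
    and t: "N (x + y) \<le> N x + N y" for r x y
    using assms by (auto simp: is_norm_def)
  have m: "N (- x) = N x" for x
    using s[of "-1" x] by simp
  show ?thesis
  proof
    fix x y u
    show "0 \<le> N (x - y)"
      using t[of "x - y" "- (x - y)"] z[of 0] m[of "x - y"] by simp
    show "N (x - y) = N (y - x)"
      using m[of "x - y"] by simp
    show "N (x - y) = 0 \<longleftrightarrow> x = y"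
      using z[of "x - y"] by simp
    show "N (x - u) \<le> N (x - y) + N (y - u)"
      using t[of "x - y" "y - u"] by simp
  qed
qed

lemma norm_metric_simps:
  assumes "is_norm N"
  shows "mspace (norm_metric N) = UNIV" and "mdist (norm_metric N) x y = N (x - y)"
proof -
  interpret Metric_space UNIV "\<lambda>x y. N (x - y)"
    using assms by (rule Metric_space_norm)
  show "mspace (norm_metric N) = UNIV" "mdist (norm_metric N) x y = N (x - y)"
    by (simp_all add: norm_metric_def)
qed

lemma is_norm_infnorm: "is_norm (infnorm :: 'v::euclidean_space \<Rightarrow> real)"
  by (simp add: is_norm_def infnorm_eq_0 infnorm_mul infnorm_triangle)

definition dual_norm :: "('v::real_inner \<Rightarrow> real) \<Rightarrow> 'v \<Rightarrow> real" where
  "dual_norm N u = Sup {u \<bullet> x | x. N x \<le> 1}"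


section \<open>The Lipschitz modulus of a set-valued mapping\<close>

text \<open>The distance to a set; the infimum over the empty set in \<^typ>\<open>ennreal\<close> is \<open>\<infinity>\<close>
  (in contrast to \<^const>\<open>infdist\<close>).\<close>

definition set_dist :: "'b metric \<Rightarrow> 'b \<Rightarrow> 'b set \<Rightarrow> ennreal" where
  "set_dist Y z A = (INF w\<in>A. ennreal (mdist Y z w))"

definition lip :: "'a metric \<Rightarrow> 'b metric \<Rightarrow> ('a \<Rightarrow> 'b set) \<Rightarrow> 'a \<Rightarrow> 'b \<Rightarrow> ennreal" where
  "lip X Y M y0 z0 = Inf {ennreal l | l. 0 \<le> l \<and>
     (\<exists>U V. openin (mtopology_of X) U \<and> y0 \<in> U \<and> openin (mtopology_of Y) V \<and> z0 \<in> V \<and>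
        (\<forall>y\<in>U. \<forall>y'\<in>U. \<forall>z \<in> V \<inter> M y. set_dist Y z (M y') \<le> ennreal (l * mdist X y y')))}"

text \<open>Multiplication of a modulus by a nonnegative real with the convention
  \<open>0 \<cdot> \<infinity> = \<infinity>\<close>; the library product on \<^typ>\<open>ennreal\<close> has \<open>0 \<cdot> \<infinity> = 0\<close>. The two agree
  whenever the real factor is positive or the modulus is finite. In the remaining case, \<open>c = 0\<close>
  and \<open>b\<close> a boundary point of the set of feasible right-hand sides, all the moduli of the
  optimal value and feasible set mappings considered below are infinite.\<close>

definition scale_modulus :: "real \<Rightarrow> ennreal \<Rightarrow> ennreal" where
  "scale_modulus r l = (if l = \<infinity> then \<infinity> else ennreal r * l)"


section \<open>Linear programs under right-hand side perturbations\<close>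

definition feasible :: "('m \<Rightarrow> real^'n) \<Rightarrow> real^'m \<Rightarrow> (real^'n) set" where
  "feasible a b = {x. \<forall>t. a t \<bullet> x \<le> b $ t}"

definition optimal :: "('m \<Rightarrow> real^'n) \<Rightarrow> real^'n \<Rightarrow> real^'m \<Rightarrow> (real^'n) set" where
  "optimal a c b = {x \<in> feasible a b. \<forall>y \<in> feasible a b. c \<bullet> x \<le> c \<bullet> y}"

text \<open>This is a real infimum, hence unspecified for infeasible or unbounded problems. It is only
  used for those \<open>b\<close> for which the minimum is attained.\<close>

definition opt_value :: "('m \<Rightarrow> real^'n) \<Rightarrow> real^'n \<Rightarrow> real^'m \<Rightarrow> real" where
  "opt_value a c b = (INF x \<in> feasible a b. c \<bullet> x)"

definition opt_value_map :: "('m \<Rightarrow> real^'n) \<Rightarrow> real^'n \<Rightarrow> real^'m \<Rightarrow> real set" where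
  "opt_value_map a c b = (if optimal a c b \<noteq> {} then {opt_value a c b} else {})"

definition polar :: "'v::real_inner set \<Rightarrow> 'v set" where
  "polar S = {u. \<forall>s\<in>S. 0 \<le> s \<bullet> u}"

text \<open>The sums below are Minkowski sums of sets.\<close>

definition epi_value_map :: "('m \<Rightarrow> real^'n) \<Rightarrow> real^'n \<Rightarrow> real^'m \<Rightarrow> real set" where
  "epi_value_map a c b = opt_value_map a c b + {0..}"

definition epi_feasible :: "('m \<Rightarrow> real^'n) \<Rightarrow> real^'n \<Rightarrow> real^'m \<Rightarrow> (real^'n) set" where
  "epi_feasible a c b = feasible a b + polar {c}"

end

theory Submission
  imports Defs
begin

text \<open>Let \<open>D\<close> be the set of all \<open>b\<close> with a nonempty feasible set and \<open>\<theta>\<close> the optimal value function.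
  Since \<open>- c\<close> lies in the cone generated by the \<open>a t\<close>, the objective is bounded below on every
  feasible set (\<open>objective_bounded_below\<close>), and a bounded linear program attains its minimum
  (\<open>optimal_nonempty_if_bounded\<close>). Hence all three mappings are empty off \<open>D\<close>, while for \<open>b \<in> D\<close>
  their values are \<open>{\<theta> b}\<close>, the ray \<open>{\<theta> b..}\<close>, and \<open>{x. \<theta> b \<le> c \<bullet> x}\<close>. The last is a half-space
  unless \<open>c = 0\<close>.

  From here on no linear programming is involved. To be a Lipschitz constant of any of the three
  mappings is, up to a factor, one and the same property of \<open>\<theta>\<close>, namely that
  \<open>b\<^sub>0\<close> is interior to \<open>D\<close> and \<open>\<theta>\<close> satisfies a Lipschitz estimate near \<open>b\<^sub>0\<close>
  (\<open>lipschitz_on_nbhd\<close>). Interiority is forced because the distance to the empty set is infinite.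
  The distance from \<open>x\<close> to the half-space \<open>{w. \<theta> b \<le> c \<bullet> w}\<close> is the positive part of
  \<open>\<theta> b - c \<bullet> x\<close> divided by the dual norm of \<open>c\<close> (\<open>set_dist_halfspace\<close>), so that \<open>l\<close> is a constant
  of the half-space mapping exactly if \<open>l\<close> times the dual norm is one for \<open>\<theta>\<close>
  (\<open>lipschitz_near_halfspace_iff\<close>); the ray is the instance \<open>c = 1\<close> in the real line. Passing to
  infima gives the theorem if \<open>c \<noteq> 0\<close>. If \<open>c = 0\<close>, then \<open>\<theta>\<close> vanishes on \<open>D\<close>, and
  all moduli are \<open>0\<close> or \<open>\<infinity>\<close> according to whether \<open>b\<^sub>0\<close> is interior to \<open>D\<close>.\<close>

section \<open>Norms on Euclidean spaces\<close>

lemma is_norm_abs: "is_norm (abs :: real \<Rightarrow> real)"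
  by (auto simp: is_norm_def abs_mult abs_triangle_ineq)

lemma norm_metric_abs: "norm_metric (abs :: real \<Rightarrow> real) = euclidean_metric"
proof -
  have "(\<lambda>x y. \<bar>x - y\<bar>) = (dist :: real \<Rightarrow> real \<Rightarrow> real)"
    by (simp add: fun_eq_iff dist_real_def)
  then show ?thesis by (simp add: norm_metric_def euclidean_metric_def)
qed

context
  fixes N :: "'v::real_vector \<Rightarrow> real"
  assumes N: "is_norm N"
begin

lemma is_norm_eq_0_iff: "N x = 0 \<longleftrightarrow> x = 0"
  using N by (simp add: is_norm_def)

lemma is_norm_scaleR: "N (r *\<^sub>R x) = \<bar>r\<bar> * N x"
  using N by (simp add: is_norm_def)

lemma is_norm_triangle: "N (x + y) \<le> N x + N y"
  using N by (simp add: is_norm_def)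

lemma is_norm_0: "N 0 = 0"
  by (simp add: is_norm_eq_0_iff)

lemma is_norm_minus: "N (- x) = N x"
  using is_norm_scaleR[of "-1" x] by simp

lemma is_norm_minus_commute: "N (x - y) = N (y - x)"
  using is_norm_minus[of "x - y"] by simp

lemma is_norm_nonneg: "0 \<le> N x"
  using is_norm_triangle[of x "- x"] by (simp add: is_norm_minus is_norm_0)

lemma is_norm_diff_le: "\<bar>N x - N y\<bar> \<le> N (x - y)"
  using is_norm_triangle[of "x - y" y] is_norm_triangle[of "y - x" x]
  by (simp add: is_norm_minus_commute[of y x])

end

context
  fixes N :: "'v::euclidean_space \<Rightarrow> real"
  assumes N: "is_norm N"
begin

lemma is_norm_continuous: "continuous_on S N"
proof -
  define C where "C = (\<Sum>i\<in>Basis. N i) "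
  have C0: "0 \<le> C"
    unfolding C_def by (intro sum_nonneg is_norm_nonneg N)
  have sum_le: "N (\<Sum>i\<in>I. f i) \<le> (\<Sum>i\<in>I. N (f i))" if "finite I" for I and f :: "'v \<Rightarrow> 'v"
    using that
  proof (induction I rule: finite_induct)
    case empty
    then show ?case by (simp add: is_norm_0[OF N])
  next
    case (insert i I)
    then show ?case using is_norm_triangle[OF N, of "f i" "sum f I"] by simp
  qed
  have upper: "N x \<le> C * norm x" for x
  proof -
    have "N x = N (\<Sum>i\<in>Basis. (x \<bullet> i) *\<^sub>R i)"
      by (simp add: euclidean_representation)
    also have "\<dots> \<le> (\<Sum>i\<in>Basis. N ((x \<bullet> i) *\<^sub>R i))"
      by (rule sum_le) simp
    also have "\<dots> \<le> (\<Sum>i\<in>Basis. norm x * N i)"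
      by (intro sum_mono) (simp add: is_norm_scaleR[OF N] mult_right_mono Basis_le_norm is_norm_nonneg[OF N])
    also have "\<dots> = C * norm x"
      by (simp add: C_def sum_distrib_left mult.commute)
    finally show ?thesis .
  qed
  have "C-lipschitz_on UNIV N"
  proof (rule lipschitz_onI)
    fix x y :: 'v
    show "dist (N x) (N y) \<le> C * dist x y"
      using is_norm_diff_le[OF N, of x y] upper[of "x - y"] by (simp add: dist_real_def dist_norm)
  qed (rule C0)
  then show ?thesis
    using lipschitz_on_continuous_on continuous_on_subset by blast
qed

text \<open>On the Euclidean unit sphere \<open>N\<close> has a positive minimum, which bounds its unit ball. By
  compactness the supremum that defines the dual norm is attained.\<close>

lemma compact_unit_ball: "compact {x. N x \<le> 1}"
proof -
  have "closed {x. N x \<le> 1}"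
    by (intro closed_Collect_le is_norm_continuous continuous_on_const)
  moreover have "bounded {x. N x \<le> 1}"
  proof (cases "sphere (0::'v) 1 = {}")
    case True
    then have "x = 0" for x :: 'v
      by (metis empty_iff mem_sphere_0 norm_sgn)
    then have "{x. N x \<le> 1} \<subseteq> {0}" by auto
    then show ?thesis by (rule bounded_subset[rotated]) simp
  next
    case False
    then obtain v where v: "norm v = 1" "\<And>x. norm x = 1 \<Longrightarrow> N v \<le> N x"
      using continuous_attains_inf[OF compact_sphere False is_norm_continuous] by auto
    have pos: "0 < N v"
      using v(1) is_norm_nonneg[OF N, of v] is_norm_eq_0_iff[OF N, of v] by force
    have "norm x \<le> 1 / N v" if "N x \<le> 1" for x
    proof (cases "x = 0")
      case True
      then show ?thesis using pos by simp
    next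
      case False
      have "N v \<le> N (inverse (norm x) *\<^sub>R x)"
        by (rule v(2)) (use False in simp)
      also have "\<dots> = N x / norm x"
        by (simp add: is_norm_scaleR[OF N] divide_inverse mult.commute)
      also have "\<dots> \<le> 1 / norm x"
        using that False by (simp add: divide_right_mono)
      finally show ?thesis
        using pos False by (simp add: field_simps)
    qed
    then show ?thesis by (auto simp: bounded_iff)
  qed
  ultimately show ?thesis by (simp add: compact_eq_bounded_closed)
qed

lemma dual_norm_attained:
  obtains u where "N u \<le> 1" "c \<bullet> u = dual_norm N c"
    and "\<And>x. N x \<le> 1 \<Longrightarrow> c \<bullet> x \<le> dual_norm N c"
proof -
  have "{x. N x \<le> 1} \<noteq> {}"
    using is_norm_0[OF N] by (auto intro: exI[of _ 0])
  moreover have "continuous_on {x. N x \<le> 1} (\<lambda>x. c \<bullet> x)"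
    by (intro continuous_intros)
  ultimately obtain u where u: "N u \<le> 1" "\<And>x. N x \<le> 1 \<Longrightarrow> c \<bullet> x \<le> c \<bullet> u"
    using continuous_attains_sup[OF compact_unit_ball] by blast
  have "dual_norm N c = c \<bullet> u"
    unfolding dual_norm_def by (rule cSup_eq_maximum) (use u in \<open>auto simp: inner_commute\<close>)
  then show thesis using that u by metis
qed

lemma inner_le_dual_norm: "c \<bullet> x \<le> dual_norm N c * N x"
proof (cases "x = 0")
  case False
  then have pos: "0 < N x"
    using is_norm_nonneg[OF N, of x] is_norm_eq_0_iff[OF N, of x] by linarith
  then have "N (inverse (N x) *\<^sub>R x) \<le> 1"
    by (simp add: is_norm_scaleR[OF N])
  then have "c \<bullet> (inverse (N x) *\<^sub>R x) \<le> dual_norm N c"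
    using dual_norm_attained by blast
  then show ?thesis using pos by (simp add: field_simps)
qed (simp add: is_norm_0[OF N])

lemma dual_norm_pos:
  assumes "c \<noteq> 0"
  shows "0 < dual_norm N c"
proof -
  have "0 < c \<bullet> c" using assms by simp
  also have "\<dots> \<le> dual_norm N c * N c" by (rule inner_le_dual_norm)
  finally show ?thesis
    using is_norm_nonneg[OF N, of c] by (simp add: zero_less_mult_iff)
qed

text \<open>Moving along a unit vector at which \<open>c\<close> attains its dual norm is the shortest way into the
  half-space. For a point that already lies in it, \<^term>\<open>ennreal\<close> truncates the negative value
  on the right to zero.\<close>

lemma set_dist_halfspace:
  assumes "c \<noteq> 0"
  shows "set_dist (norm_metric N) x {w. \<beta> \<le> c \<bullet> w} = ennreal ((\<beta> - c \<bullet> x) / dual_norm N c)"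
proof (rule antisym)
  let ?\<delta> = "dual_norm N c"
  have pos: "0 < ?\<delta>" using assms by (rule dual_norm_pos)
  show "set_dist (norm_metric N) x {w. \<beta> \<le> c \<bullet> w} \<le> ennreal ((\<beta> - c \<bullet> x) / ?\<delta>)"
  proof (cases "\<beta> \<le> c \<bullet> x")
    case True
    then show ?thesis
      unfolding set_dist_def norm_metric_simps[OF N]
      by (intro INF_lower2[of x]) (auto simp: is_norm_0[OF N])
  next
    case False
    obtain u where u: "N u \<le> 1" "c \<bullet> u = ?\<delta>"
      using dual_norm_attained by blast
    define s where "s = (\<beta> - c \<bullet> x) / ?\<delta>"
    have s: "0 \<le> s" using False pos by (simp add: s_def)
    have "c \<bullet> (x + s *\<^sub>R u) = \<beta>"
      using pos by (simp add: inner_add_right u s_def)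
    moreover have "N (x - (x + s *\<^sub>R u)) \<le> s"
      using s u(1) by (simp add: is_norm_minus[OF N] is_norm_scaleR[OF N] mult_left_le)
    ultimately show ?thesis
      unfolding set_dist_def norm_metric_simps[OF N] s_def[symmetric]
      by (intro INF_lower2[of "x + s *\<^sub>R u"] ennreal_leI) auto
  qed
  show "ennreal ((\<beta> - c \<bullet> x) / ?\<delta>) \<le> set_dist (norm_metric N) x {w. \<beta> \<le> c \<bullet> w}"
    unfolding set_dist_def norm_metric_simps[OF N]
  proof (intro INF_greatest ennreal_leI)
    fix w assume "w \<in> {w. \<beta> \<le> c \<bullet> w}"
    then have "\<beta> - c \<bullet> x \<le> c \<bullet> (w - x)" by (simp add: inner_diff_right)
    also have "\<dots> \<le> ?\<delta> * N (x - w)"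
      using inner_le_dual_norm[of c "w - x"] by (simp add: is_norm_minus_commute[OF N, of w x])
    finally show "(\<beta> - c \<bullet> x) / ?\<delta> \<le> N (x - w)"
      using pos by (simp add: field_simps)
  qed
qed

end

lemma dual_norm_abs: "dual_norm abs (1::real) = 1"
  unfolding dual_norm_def by (rule cSup_eq_maximum) (auto intro: exI[of _ 1])


section \<open>Lipschitz constants of set-valued mappings between normed spaces\<close>

text \<open>The constants over which the Lipschitz modulus is an infimum, with the two neighbourhoods
  replaced by balls of one common radius.\<close>

definition lipschitz_near ::
  "('v::real_vector \<Rightarrow> real) \<Rightarrow> ('w::real_vector \<Rightarrow> real) \<Rightarrow> ('v \<Rightarrow> 'w set) \<Rightarrow> 'v \<Rightarrow> 'w \<Rightarrow> real \<Rightarrow> bool"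
where
  "lipschitz_near p q M y0 z0 l \<longleftrightarrow> 0 \<le> l \<and>
     (\<exists>r>0. \<forall>y y' z. p (y - y0) < r \<and> p (y' - y0) < r \<and> q (z - z0) < r \<and> z \<in> M y \<longrightarrow>
        set_dist (norm_metric q) z (M y') \<le> ennreal (l * p (y - y')))"

lemma openin_norm_metric:
  assumes "is_norm p"
  shows "openin (mtopology_of (norm_metric p)) U \<longleftrightarrow> (\<forall>x\<in>U. \<exists>r>0. {y. p (y - x) < r} \<subseteq> U)"
proof -
  interpret Metric_space UNIV "\<lambda>x y. p (x - y)"
    using assms by (rule Metric_space_norm)
  have "mball x r = {y. p (y - x) < r}" for x r
    by (auto simp: mball_def is_norm_minus_commute[OF assms, of x])
  then show ?thesis
    by (auto simp: norm_metric_def openin_mtopology)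
qed

lemma openin_norm_ball:
  assumes "is_norm p"
  shows "openin (mtopology_of (norm_metric p)) {y. p (y - x) < r}"
  unfolding openin_norm_metric[OF assms]
proof
  fix y assume y: "y \<in> {y. p (y - x) < r}"
  have "p (z - x) < r" if "p (z - y) < r - p (y - x)" for z
    using is_norm_triangle[OF assms, of "z - y" "y - x"] that by simp
  then show "\<exists>e>0. {z. p (z - y) < e} \<subseteq> {y. p (y - x) < r}"
    using y by (intro exI[of _ "r - p (y - x)"]) auto
qed

lemma lip_eq_Inf_lipschitz_near:
  assumes p: "is_norm p" and q: "is_norm q"
  shows "lip (norm_metric p) (norm_metric q) M y0 z0
       = Inf (ennreal ` {l. lipschitz_near p q M y0 z0 l})"
proof -
  let ?P = "\<lambda>l U V. \<forall>y\<in>U. \<forall>y'\<in>U. \<forall>z\<in>V \<inter> M y.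
    set_dist (norm_metric q) z (M y') \<le> ennreal (l * p (y - y'))"
  have "(\<exists>U V. openin (mtopology_of (norm_metric p)) U \<and> y0 \<in> U \<and>
           openin (mtopology_of (norm_metric q)) V \<and> z0 \<in> V \<and> ?P l U V) \<longleftrightarrow>
        (\<exists>r>0. \<forall>y y' z. p (y - y0) < r \<and> p (y' - y0) < r \<and> q (z - z0) < r \<and> z \<in> M y \<longrightarrow>
           set_dist (norm_metric q) z (M y') \<le> ennreal (l * p (y - y')))" (is "?L \<longleftrightarrow> ?R") for l
  proof
    assume ?L
    then obtain U V where UV: "openin (mtopology_of (norm_metric p)) U" "y0 \<in> U"
      "openin (mtopology_of (norm_metric q)) V" "z0 \<in> V" "?P l U V" by blast
    obtain r1 where r1: "r1 > 0" "{y. p (y - y0) < r1} \<subseteq> U"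
      using UV(1,2) unfolding openin_norm_metric[OF p] by blast
    obtain r2 where r2: "r2 > 0" "{z. q (z - z0) < r2} \<subseteq> V"
      using UV(3,4) unfolding openin_norm_metric[OF q] by blast
    show ?R
      using r1 r2 UV(5) by (intro exI[of _ "min r1 r2"]) (auto simp: subset_iff)
  next
    assume ?R
    then obtain r where r: "r > 0" "\<forall>y y' z. p (y - y0) < r \<and> p (y' - y0) < r \<and> q (z - z0) < r \<and>
      z \<in> M y \<longrightarrow> set_dist (norm_metric q) z (M y') \<le> ennreal (l * p (y - y'))" by blast
    show ?L
      using r
      by (intro exI[of _ "{y. p (y - y0) < r}"] exI[of _ "{z. q (z - z0) < r}"])
         (auto simp: openin_norm_ball p q is_norm_0)
  qed
  then show ?thesis
    unfolding lip_def lipschitz_near_def norm_metric_simps[OF p]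
    by (intro arg_cong[of _ _ Inf]) auto
qed

text \<open>The distance from \<open>z0\<close> to an empty value would be infinite, whatever the constant.\<close>

lemma lipschitz_near_nonempty_values:
  assumes p: "is_norm p" and q: "is_norm q"
    and "lipschitz_near p q M y0 z0 l" and z0: "z0 \<in> M y0"
  shows "\<exists>r>0. \<forall>y. p (y - y0) < r \<longrightarrow> M y \<noteq> {}"
proof -
  obtain r where r: "r > 0" "\<And>y y' z. p (y - y0) < r \<Longrightarrow> p (y' - y0) < r \<Longrightarrow> q (z - z0) < r \<Longrightarrow>
      z \<in> M y \<Longrightarrow> set_dist (norm_metric q) z (M y') \<le> ennreal (l * p (y - y'))"
    using assms(3) unfolding lipschitz_near_def by blast
  have "M y \<noteq> {}" if "p (y - y0) < r" for y
  proof
    assume "M y = {}"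
    with r(2)[of y0 y z0] r(1) that z0 show False
      by (simp add: is_norm_0[OF p] is_norm_0[OF q] set_dist_def top_unique)
  qed
  with r(1) show ?thesis by blast
qed


section \<open>Lipschitz constants of real functions on a domain\<close>

text \<open>The membership in \<open>D\<close> makes \<open>y0\<close> an interior point of \<open>D\<close>, and exchanging \<open>y\<close> and \<open>y'\<close>
  turns the one-sided estimate into one for the absolute value.\<close>

definition lipschitz_on_nbhd ::
  "('v::real_vector \<Rightarrow> real) \<Rightarrow> 'v set \<Rightarrow> ('v \<Rightarrow> real) \<Rightarrow> 'v \<Rightarrow> real \<Rightarrow> bool" where
  "lipschitz_on_nbhd p D \<theta> y0 l \<longleftrightarrow> 0 \<le> l \<and>
     (\<exists>r>0. \<forall>y y'. p (y - y0) < r \<and> p (y' - y0) < r \<longrightarrow>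
        y \<in> D \<and> \<theta> y' - \<theta> y \<le> l * p (y - y'))"

text \<open>A radius on which a Lipschitz estimate forces values within a prescribed tolerance.\<close>

lemma small_radius:
  fixes l r \<eta> :: real
  assumes "0 \<le> l" "0 < r" "0 < \<eta>"
  obtains r' where "0 < r'" "r' \<le> r" "\<And>s. 0 \<le> s \<Longrightarrow> s < r' \<Longrightarrow> l * s < \<eta>"
proof
  let ?r = "min r (\<eta> / (l + 1))"
  show "0 < ?r" "?r \<le> r" using assms by auto
  fix s assume s: "0 \<le> s" "s < ?r"
  have "l * s \<le> (l + 1) * s" using s by (simp add: mult_right_mono)
  also have "\<dots> < \<eta>" using s assms by (simp add: field_simps)
  finally show "l * s < \<eta>" .
qed

lemma lipschitz_near_singleton_iff:
  fixes p :: "'v::real_vector \<Rightarrow> real" and \<theta> :: "'v \<Rightarrow> real"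
  assumes p: "is_norm p" and y0: "y0 \<in> D"
  defines "M \<equiv> \<lambda>y. if y \<in> D then {\<theta> y} else {}"
  shows "lipschitz_near p abs M y0 (\<theta> y0) l \<longleftrightarrow> lipschitz_on_nbhd p D \<theta> y0 l"
proof
  assume near: "lipschitz_near p abs M y0 (\<theta> y0) l"
  then have l: "0 \<le> l" by (simp add: lipschitz_near_def)
  have lp: "0 \<le> l * p y" for y using l is_norm_nonneg[OF p] by simp
  obtain r1 where r1: "r1 > 0" "\<And>y. p (y - y0) < r1 \<Longrightarrow> y \<in> D"
    using lipschitz_near_nonempty_values[OF p is_norm_abs near] y0
    by (auto simp: M_def split: if_splits)
  obtain r2 where r2: "r2 > 0" "\<And>y y' z. p (y - y0) < r2 \<Longrightarrow> p (y' - y0) < r2 \<Longrightarrow>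
      \<bar>z - \<theta> y0\<bar> < r2 \<Longrightarrow> z \<in> M y \<Longrightarrow> set_dist (norm_metric abs) z (M y') \<le> ennreal (l * p (y - y'))"
    using near unfolding lipschitz_near_def by blast
  have est: "\<bar>\<theta> y - \<theta> y'\<bar> \<le> l * p (y - y')"
    if "p (y - y0) < min r1 r2" "p (y' - y0) < min r1 r2" "\<bar>\<theta> y - \<theta> y0\<bar> < r2" for y y'
  proof -
    have "y \<in> D" "y' \<in> D" using r1 that by auto
    then show ?thesis
      using r2(2)[of y y' "\<theta> y"] that lp[of "y - y'"]
      by (simp add: M_def set_dist_def norm_metric_simps[OF is_norm_abs])
  qed
  \<comment> \<open>The estimate with base point \<open>y0\<close> gives continuity there, which keeps all nearby values
    in the neighbourhood of \<open>\<theta> y0\<close> on which the estimate is available.\<close>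
  obtain r where r: "0 < r" "r \<le> min r1 r2" "\<And>s. 0 \<le> s \<Longrightarrow> s < r \<Longrightarrow> l * s < r2"
    using small_radius[OF l, of "min r1 r2" r2] r1(1) r2(1) by auto
  have close: "\<bar>\<theta> y - \<theta> y0\<bar> < r2" if "p (y - y0) < r" for y
  proof -
    have "\<bar>\<theta> y0 - \<theta> y\<bar> \<le> l * p (y0 - y)"
      using est[of y0 y] that r r1(1) r2(1) by (simp add: is_norm_0[OF p])
    also have "\<dots> = l * p (y - y0)"
      by (simp add: is_norm_minus_commute[OF p, of y0 y])
    also have "\<dots> < r2"
      using r(3) that is_norm_nonneg[OF p] by blast
    finally show ?thesis by (simp add: abs_minus_commute)
  qed
  show "lipschitz_on_nbhd p D \<theta> y0 l"
    unfolding lipschitz_on_nbhd_def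
  proof (intro conjI exI[of _ r] allI impI)
    fix y y' assume y: "p (y - y0) < r \<and> p (y' - y0) < r"
    show "y \<in> D" using y r r1 by auto
    show "\<theta> y' - \<theta> y \<le> l * p (y - y')"
      using est[of y y'] close[of y] y r by auto
  qed (use l r in auto)
next
  assume "lipschitz_on_nbhd p D \<theta> y0 l"
  then obtain r where l: "0 \<le> l" and r: "r > 0"
    "\<And>y y'. p (y - y0) < r \<Longrightarrow> p (y' - y0) < r \<Longrightarrow> y \<in> D \<and> \<theta> y' - \<theta> y \<le> l * p (y - y')"
    unfolding lipschitz_on_nbhd_def by blast
  show "lipschitz_near p abs M y0 (\<theta> y0) l"
    unfolding lipschitz_near_def
  proof (intro conjI exI[of _ r] allI impI)
    fix y y' z
    assume A: "p (y - y0) < r \<and> p (y' - y0) < r \<and> \<bar>z - \<theta> y0\<bar> < r \<and> z \<in> M y"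
    have "y \<in> D" "y' \<in> D" "\<bar>\<theta> y - \<theta> y'\<bar> \<le> l * p (y - y')"
      using A r(2)[of y y'] r(2)[of y' y] is_norm_minus_commute[OF p, of y' y] by auto
    then show "set_dist (norm_metric abs) z (M y') \<le> ennreal (l * p (y - y'))"
      using A by (simp add: M_def set_dist_def norm_metric_simps[OF is_norm_abs] ennreal_leI)
  qed (use l r in auto)
qed

text \<open>By the distance formula, the estimate at a point \<open>x\<close> of the half-space for \<open>y\<close> bounds
  \<open>\<theta> y' - c \<bullet> x\<close>, and it is sharpest at boundary points, where \<open>c \<bullet> x = \<theta> y\<close>. A difficulty is
  that the estimate is only available for \<open>x\<close> near \<open>x0\<close>. That boundary points of this kind exist
  for all \<open>y\<close> near \<open>y0\<close>, that is, continuity of \<open>\<theta>\<close> at \<open>y0\<close>, is itself a consequence of the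
  estimate.\<close>

lemma lipschitz_near_halfspace_iff:
  fixes p :: "'v::real_vector \<Rightarrow> real" and N :: "'w::euclidean_space \<Rightarrow> real" and \<theta> :: "'v \<Rightarrow> real"
  assumes p: "is_norm p" and N: "is_norm N" and c: "c \<noteq> 0"
    and y0: "y0 \<in> D" and x0: "c \<bullet> x0 = \<theta> y0"
  defines "M \<equiv> \<lambda>y. if y \<in> D then {x. \<theta> y \<le> c \<bullet> x} else {}"
  shows "lipschitz_near p N M y0 x0 l \<longleftrightarrow> lipschitz_on_nbhd p D \<theta> y0 (dual_norm N c * l)"
proof
  define \<delta> where "\<delta> = dual_norm N c"
  have \<delta>: "0 < \<delta>" unfolding \<delta>_def using N c by (rule dual_norm_pos)
  assume near: "lipschitz_near p N M y0 x0 l"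
  then have l: "0 \<le> l" by (simp add: lipschitz_near_def)
  then have \<delta>l: "0 \<le> \<delta> * l" using \<delta> by simp
  obtain r1 where r1: "r1 > 0" "\<And>y. p (y - y0) < r1 \<Longrightarrow> y \<in> D"
    using lipschitz_near_nonempty_values[OF p N near] y0 x0
    by (auto simp: M_def split: if_splits)
  obtain r2 where r2: "r2 > 0" "\<And>y y' x. p (y - y0) < r2 \<Longrightarrow> p (y' - y0) < r2 \<Longrightarrow>
      N (x - x0) < r2 \<Longrightarrow> x \<in> M y \<Longrightarrow> set_dist (norm_metric N) x (M y') \<le> ennreal (l * p (y - y'))"
    using near unfolding lipschitz_near_def by blast
  obtain u where u: "N u \<le> 1" "c \<bullet> u = \<delta>"
    using dual_norm_attained[OF N] unfolding \<delta>_def by blast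
  define \<eta> where "\<eta> = \<delta> * r2"
  have \<eta>: "0 < \<eta>" using \<delta> r2(1) by (simp add: \<eta>_def)
  \<comment> \<open>Points \<open>x\<close> on the line through \<open>x0\<close> in direction \<open>u\<close> realise every value near \<open>\<theta> y0\<close>, so the
    estimate for points becomes an estimate for values.\<close>
  have est: "\<theta> y' - z \<le> \<delta> * l * p (y - y')"
    if "p (y - y0) < min r1 r2" "p (y' - y0) < min r1 r2" "\<bar>z - \<theta> y0\<bar> < \<eta>" "\<theta> y \<le> z" for y y' z
  proof -
    define x where "x = x0 + ((z - \<theta> y0) / \<delta>) *\<^sub>R u"
    have cx: "c \<bullet> x = z"
      using \<delta> by (simp add: x_def inner_add_right x0 u)
    have "N (x - x0) \<le> \<bar>z - \<theta> y0\<bar> / \<delta>"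
      using \<delta> u(1) by (simp add: x_def is_norm_scaleR[OF N] mult_left_le divide_right_mono)
    also have "\<dots> < r2"
      using that(3) \<delta> by (simp add: \<eta>_def field_simps)
    finally have "set_dist (norm_metric N) x (M y') \<le> ennreal (l * p (y - y'))"
      using r2(2)[of y y' x] r1(2)[of y] that cx by (simp add: M_def)
    moreover have "y' \<in> D" using r1 that by auto
    moreover have "0 \<le> l * p (y - y')" using l is_norm_nonneg[OF p] by simp
    ultimately have "(\<theta> y' - z) / \<delta> \<le> l * p (y - y')"
      by (simp add: M_def set_dist_halfspace[OF N c] cx \<delta>_def[symmetric] ennreal_le_iff)
    then show ?thesis using \<delta> by (simp add: field_simps)
  qed
  obtain r where r: "0 < r" "r \<le> min r1 r2" "\<And>s. 0 \<le> s \<Longrightarrow> s < r \<Longrightarrow> \<delta> * l * s < \<eta> / 2"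
    using small_radius[OF \<delta>l, of "min r1 r2" "\<eta> / 2"] r1(1) r2(1) \<eta> by auto
  have close: "\<bar>\<theta> y - \<theta> y0\<bar> < \<eta>" if y: "p (y - y0) < r" for y
  proof -
    have small: "\<delta> * l * p (y - y0) < \<eta> / 2"
      using r(3) y is_norm_nonneg[OF p] by blast
    have upper: "\<theta> y - \<theta> y0 < \<eta> / 2"
      using est[of y0 y "\<theta> y0"] y r \<eta> small
      by (simp add: is_norm_0[OF p] is_norm_minus_commute[OF p, of y0 y])
    \<comment> \<open>For the lower bound a value below \<open>\<theta> y0\<close> is needed that stays in the neighbourhood even
      if \<open>\<theta> y\<close> should be far below.\<close>
    define z where "z = max (\<theta> y) (\<theta> y0 - \<eta> / 2)"
    have "\<theta> y0 - z \<le> \<delta> * l * p (y - y0)"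
      by (rule est) (use y r upper \<eta> in \<open>auto simp: z_def is_norm_0[OF p]\<close>)
    then have "\<theta> y0 - \<eta> / 2 < z" using small by linarith
    then have "\<theta> y0 - \<eta> / 2 < \<theta> y" by (auto simp: z_def)
    with upper \<eta> show ?thesis by linarith
  qed
  show "lipschitz_on_nbhd p D \<theta> y0 (dual_norm N c * l)"
    unfolding lipschitz_on_nbhd_def \<delta>_def[symmetric]
  proof (intro conjI exI[of _ r] allI impI)
    fix y y' assume y: "p (y - y0) < r \<and> p (y' - y0) < r"
    show "y \<in> D" using y r r1 by auto
    show "\<theta> y' - \<theta> y \<le> \<delta> * l * p (y - y')"
      using est[of y y' "\<theta> y"] close[of y] y r by auto
  qed (use \<delta>l r in auto)
next
  define \<delta> where "\<delta> = dual_norm N c"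
  have \<delta>: "0 < \<delta>" unfolding \<delta>_def using N c by (rule dual_norm_pos)
  assume "lipschitz_on_nbhd p D \<theta> y0 (dual_norm N c * l)"
  then obtain r where \<delta>l: "0 \<le> \<delta> * l" and r: "r > 0"
    "\<And>y y'. p (y - y0) < r \<Longrightarrow> p (y' - y0) < r \<Longrightarrow> y \<in> D \<and> \<theta> y' - \<theta> y \<le> \<delta> * l * p (y - y')"
    unfolding lipschitz_on_nbhd_def \<delta>_def by blast
  have l: "0 \<le> l" using \<delta>l \<delta> by (simp add: zero_le_mult_iff)
  show "lipschitz_near p N M y0 x0 l"
    unfolding lipschitz_near_def
  proof (intro conjI exI[of _ r] allI impI)
    fix y y' x
    assume A: "p (y - y0) < r \<and> p (y' - y0) < r \<and> N (x - x0) < r \<and> x \<in> M y"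
    have D: "y \<in> D" "y' \<in> D" and le: "\<theta> y' - \<theta> y \<le> \<delta> * l * p (y - y')"
      using A r(2)[of y y'] r(2)[of y' y] by auto
    have "(\<theta> y' - c \<bullet> x) / \<delta> \<le> l * p (y - y')"
      using A D le \<delta> by (simp add: M_def field_simps)
    then show "set_dist (norm_metric N) x (M y') \<le> ennreal (l * p (y - y'))"
      using D by (simp add: M_def set_dist_halfspace[OF N c] \<delta>_def[symmetric] ennreal_leI)
  qed (use l r in auto)
qed

lemma lipschitz_near_atLeast_iff:
  fixes p :: "'v::real_vector \<Rightarrow> real"
  assumes "is_norm p" "y0 \<in> D"
  shows "lipschitz_near p abs (\<lambda>y. if y \<in> D then {\<theta> y..} else {}) y0 (\<theta> y0) l
     \<longleftrightarrow> lipschitz_on_nbhd p D \<theta> y0 l"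
proof -
  have "(\<lambda>y. if y \<in> D then {\<theta> y..} else {}) = (\<lambda>y. if y \<in> D then {x. \<theta> y \<le> 1 \<bullet> x} else {})"
    by (auto simp: fun_eq_iff)
  then show ?thesis
    using lipschitz_near_halfspace_iff[OF assms(1) is_norm_abs, of 1 y0 D "\<theta> y0" \<theta> l] assms(2)
    by (simp add: dual_norm_abs)
qed

text \<open>The degenerate case of a zero normal vector, in which the half-spaces are the whole
  space. Both sides only say that \<open>l \<ge> 0\<close> and that \<open>y0\<close> is interior to \<open>D\<close>.\<close>

lemma lipschitz_near_UNIV_iff:
  fixes p :: "'v::real_vector \<Rightarrow> real"
  assumes p: "is_norm p" and N: "is_norm N" and y0: "y0 \<in> D" and \<theta>: "\<And>y. y \<in> D \<Longrightarrow> \<theta> y = 0"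
  shows "lipschitz_near p N (\<lambda>y. if y \<in> D then UNIV else {}) y0 x0 l \<longleftrightarrow> lipschitz_on_nbhd p D \<theta> y0 l"
    (is "lipschitz_near p N ?M y0 x0 l \<longleftrightarrow> _")
proof
  assume near: "lipschitz_near p N ?M y0 x0 l"
  then have l: "0 \<le> l" by (simp add: lipschitz_near_def)
  obtain r where "r > 0" "\<And>y. p (y - y0) < r \<Longrightarrow> y \<in> D"
    using lipschitz_near_nonempty_values[OF p N near] y0 by (auto split: if_splits)
  then show "lipschitz_on_nbhd p D \<theta> y0 l"
    unfolding lipschitz_on_nbhd_def using l \<theta> is_norm_nonneg[OF p] by auto
next
  assume *: "lipschitz_on_nbhd p D \<theta> y0 l"
  then obtain r where l: "0 \<le> l" and r: "r > 0" "\<And>y. p (y - y0) < r \<Longrightarrow> y \<in> D"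
    unfolding lipschitz_on_nbhd_def by blast
  have "set_dist (norm_metric N) x UNIV \<le> e" for x e
    unfolding set_dist_def norm_metric_simps[OF N]
    by (rule INF_lower2[of x]) (auto simp: is_norm_0[OF N])
  then show "lipschitz_near p N ?M y0 x0 l"
    unfolding lipschitz_near_def using l r by auto
qed

lemma scale_modulus_Inf:
  assumes \<delta>: "0 < \<delta>" and S: "\<And>l. l \<in> S \<Longrightarrow> 0 \<le> l"
  shows "scale_modulus \<delta> (Inf (ennreal ` S)) = Inf (ennreal ` (\<lambda>l. \<delta> * l) ` S)"
proof -
  let ?X = "Inf (ennreal ` S)" and ?Y = "Inf (ennreal ` (\<lambda>l. \<delta> * l) ` S)"
  have "ennreal \<delta> * ?X \<le> ?Y"
    using \<delta> S by (auto intro!: INF_greatest mult_left_mono INF_lower simp: image_image ennreal_mult)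
  moreover have "?Y / ennreal \<delta> \<le> ?X"
  proof (rule INF_greatest)
    fix l assume l: "l \<in> S"
    then have "?Y \<le> ennreal \<delta> * ennreal l"
      using \<delta> S by (auto intro!: INF_lower2[of l] simp: image_image ennreal_mult)
    then show "?Y / ennreal \<delta> \<le> ennreal l"
      using \<delta> by (simp add: divide_le_posI_ennreal)
  qed
  then have "ennreal \<delta> * (?Y / ennreal \<delta>) \<le> ennreal \<delta> * ?X"
    by (rule mult_left_mono) simp
  moreover have "ennreal \<delta> * (?Y / ennreal \<delta>) = ?Y * ennreal \<delta> / ennreal \<delta>"
    by (simp only: ennreal_times_divide mult.commute[of "ennreal \<delta>"])
  moreover have "\<dots> = ?Y"
    using \<delta> by (intro mult_divide_eq_ennreal) simp_all
  ultimately have "ennreal \<delta> * ?X = ?Y" by (intro antisym) simp_all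
  then show ?thesis
    using \<delta> by (auto simp: scale_modulus_def ennreal_mult_top infinity_ennreal_def)
qed


section \<open>Attainment of the minimum in linear programs\<close>

text \<open>Following a direction \<open>d\<close> of descent that keeps all active constraints active, one either
  meets a further constraint or decreases the objective without bound.\<close>

lemma feasible_more_active:
  fixes a :: "'m::finite \<Rightarrow> real^'n"
  assumes x: "x \<in> feasible a b" and bdd: "\<And>y. y \<in> feasible a b \<Longrightarrow> L \<le> c \<bullet> y"
    and d: "c \<bullet> d < 0" "\<And>t. a t \<bullet> x = b $ t \<Longrightarrow> a t \<bullet> d = 0"
  obtains y where "y \<in> feasible a b" "c \<bullet> y \<le> c \<bullet> x"
    "{t. a t \<bullet> x = b $ t} \<subset> {t. a t \<bullet> y = b $ t}"
proof -
  define T where "T = {t. 0 < a t \<bullet> d}"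
  have fx: "a t \<bullet> x \<le> b $ t" for t using x by (simp add: feasible_def)
  have "T \<noteq> {}"
  proof
    assume "T = {}"
    then have nonpos: "a t \<bullet> d \<le> 0" for t by (auto simp: T_def not_less)
    define s where "s = (L - 1 - c \<bullet> x) / (c \<bullet> d)"
    have s: "0 \<le> s"
      using d(1) bdd[OF x] by (simp add: s_def divide_nonpos_neg)
    have "a t \<bullet> (x + s *\<^sub>R d) \<le> b $ t" for t
      using fx[of t] mult_nonneg_nonpos[OF s nonpos[of t]] by (simp add: inner_add_right)
    then have "L \<le> c \<bullet> (x + s *\<^sub>R d)"
      by (intro bdd) (simp add: feasible_def)
    also have "\<dots> = L - 1"
      using d(1) by (simp add: inner_add_right s_def)
    finally show False by simp
  qed
  define \<rho> where "\<rho> t = (b $ t - a t \<bullet> x) / (a t \<bullet> d)" for t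
  \<comment> \<open>The longest step along \<open>d\<close> that stays feasible; it is stopped by a constraint that was not
    active at \<open>x\<close>.\<close>
  define s where "s = Min (\<rho> ` T)"
  have "s \<in> \<rho> ` T"
    unfolding s_def by (rule Min_in) (use \<open>T \<noteq> {}\<close> in auto)
  then obtain t0 where t0: "t0 \<in> T" "s = \<rho> t0" by blast
  have s: "0 \<le> s"
    using t0 fx[of t0] by (simp add: \<rho>_def T_def)
  have s_le: "s \<le> \<rho> t" if "t \<in> T" for t
    unfolding s_def using that by simp
  define y where "y = x + s *\<^sub>R d"
  have ay: "a t \<bullet> y = a t \<bullet> x + s * (a t \<bullet> d)" for t
    by (simp add: y_def inner_add_right)
  have "a t \<bullet> y \<le> b $ t" for t
  proof (cases "t \<in> T")
    case True
    then show ?thesis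
      using s_le[OF True] by (simp add: ay \<rho>_def T_def field_simps)
  next
    case False
    then have "s * (a t \<bullet> d) \<le> 0"
      using s by (simp add: T_def mult_nonneg_nonpos)
    then show ?thesis using fx[of t] by (simp add: ay)
  qed
  then have "y \<in> feasible a b" by (simp add: feasible_def)
  moreover have "c \<bullet> y \<le> c \<bullet> x"
    using s d(1) by (simp add: y_def inner_add_right mult_nonneg_nonpos)
  moreover have "{t. a t \<bullet> x = b $ t} \<subseteq> {t. a t \<bullet> y = b $ t}"
    using d(2) by (auto simp: ay)
  moreover have "a t0 \<bullet> y = b $ t0" "a t0 \<bullet> x \<noteq> b $ t0"
    using t0 d(2)[of t0] by (auto simp: ay \<rho>_def T_def)
  ultimately show thesis by (intro that[of y]) auto
qed

text \<open>Among the feasible points that are at least as good as a given one, take one with the most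
  active constraints. Then \<open>c\<close> is spanned by the active constraint normals, since otherwise the
  component of \<open>-c\<close> orthogonal to them would be a direction as in the preceding lemma. The
  objective value at such a point depends on its set of active constraints only, so that only
  finitely many values compete for the minimum.\<close>

lemma optimal_nonempty_if_bounded:
  fixes a :: "'m::finite \<Rightarrow> real^'n"
  assumes ne: "feasible a b \<noteq> {}" and bdd: "\<And>y. y \<in> feasible a b \<Longrightarrow> L \<le> c \<bullet> y"
  shows "optimal a c b \<noteq> {}"
proof -
  define act where "act x = {t. a t \<bullet> x = b $ t}" for x
  define B where "B = {x \<in> feasible a b. c \<in> span (a ` act x)}"
  have dominated: "\<exists>y\<in>B. c \<bullet> y \<le> c \<bullet> x" if x: "x \<in> feasible a b" for x
  proof -
    let ?Q = "\<lambda>y. y \<in> feasible a b \<and> c \<bullet> y \<le> c \<bullet> x"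
    have "\<forall>y. ?Q y \<longrightarrow> card (act y) < Suc CARD('m)"
      by (auto simp: less_Suc_eq_le card_mono)
    then obtain y where y: "?Q y" and max: "\<And>z. ?Q z \<Longrightarrow> card (act z) \<le> card (act y)"
      using ex_has_greatest_nat[of ?Q x "\<lambda>y. card (act y)"] x by blast
    have "c \<in> span (a ` act y)"
    proof (rule ccontr)
      assume notin: "c \<notin> span (a ` act y)"
      obtain v w where v: "v \<in> span (a ` act y)"
        and w: "\<And>s. s \<in> span (a ` act y) \<Longrightarrow> orthogonal w s" and cvw: "c = v + w"
        using orthogonal_subspace_decomp_exists[of "a ` act y" c] by blast
      have "w \<noteq> 0" using notin v cvw by auto
      have "c \<bullet> (- w) < 0"
        using w[OF v] \<open>w \<noteq> 0\<close> by (simp add: cvw inner_add_left inner_add_right orthogonal_def inner_commute)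
      moreover have "a t \<bullet> (- w) = 0" if "a t \<bullet> y = b $ t" for t
        using w[of "a t"] that by (simp add: act_def span_base orthogonal_def inner_commute)
      ultimately obtain z where z: "z \<in> feasible a b" "c \<bullet> z \<le> c \<bullet> y" "act y \<subset> act z"
        using feasible_more_active[of y a b L c "- w"] y bdd unfolding act_def by blast
      then have "card (act y) < card (act z)"
        by (intro psubset_card_mono) auto
      with max[of z] y z show False by fastforce
    qed
    with y show ?thesis by (auto simp: B_def)
  qed
  have same_value: "c \<bullet> x = c \<bullet> y" if "x \<in> B" "y \<in> B" "act x = act y" for x y
  proof -
    have "orthogonal (x - y) s" if s: "s \<in> a ` act x" for s
    proof -
      obtain t where "s = a t" "t \<in> act x" using s by blast
      moreover have "t \<in> act y" using \<open>t \<in> act x\<close> \<open>act x = act y\<close> by simp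
      ultimately have "s \<bullet> (x - y) = 0" by (simp add: act_def inner_diff_right)
      then show ?thesis by (simp add: orthogonal_def inner_commute)
    qed
    then have "orthogonal (x - y) c"
      using \<open>x \<in> B\<close> orthogonal_to_span unfolding B_def by blast
    then show ?thesis by (simp add: orthogonal_def inner_diff_left inner_commute[of c])
  qed
  \<comment> \<open>On \<open>B\<close> the objective factors through \<open>act\<close>, which has finite range.\<close>
  define rep where "rep A = (SOME x. x \<in> B \<and> act x = A)" for A
  have "c \<bullet> x = c \<bullet> rep (act x)" if "x \<in> B" for x
  proof -
    have "rep (act x) \<in> B \<and> act (rep (act x)) = act x"
      unfolding rep_def by (rule someI[of _ x]) (use that in simp)
    then show ?thesis using same_value that by metis
  qed
  then have "(\<lambda>x. c \<bullet> x) ` B \<subseteq> (\<lambda>A. c \<bullet> rep A) ` UNIV" by auto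
  then have fin: "finite ((\<lambda>x. c \<bullet> x) ` B)"
    by (rule finite_subset) simp
  have "B \<noteq> {}" using ne dominated by blast
  then have "Min ((\<lambda>x. c \<bullet> x) ` B) \<in> (\<lambda>x. c \<bullet> x) ` B"
    by (intro Min_in fin) simp
  then obtain x where x: "x \<in> B" "c \<bullet> x = Min ((\<lambda>x. c \<bullet> x) ` B)" by auto
  have "c \<bullet> x \<le> c \<bullet> y" if y: "y \<in> feasible a b" for y
  proof -
    obtain z where z: "z \<in> B" "c \<bullet> z \<le> c \<bullet> y" using dominated[OF y] by blast
    have "c \<bullet> x \<le> c \<bullet> z" unfolding x(2) by (rule Min_le[OF fin]) (use z in simp)
    with z show ?thesis by linarith
  qed
  with x have "x \<in> optimal a c b" by (simp add: optimal_def B_def)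
  then show ?thesis by blast
qed

text \<open>Weak duality: the vectors whose inner product is bounded above on the feasible set form a
  convex cone that contains all \<open>a t\<close>.\<close>

lemma objective_bounded_below:
  fixes a :: "'m::finite \<Rightarrow> real^'n"
  assumes "- c \<in> convex_cone hull (range a)"
  obtains L where "\<And>x. x \<in> feasible a b \<Longrightarrow> L \<le> c \<bullet> x"
proof -
  define K where "K = {v. \<exists>M. \<forall>x\<in>feasible a b. v \<bullet> x \<le> M}"
  have "convex_cone K"
    unfolding convex_cone_iff
  proof (intro conjI ballI allI impI)
    show "0 \<in> K" by (auto simp: K_def)
    fix v assume "v \<in> K"
    then obtain M where M: "\<And>x. x \<in> feasible a b \<Longrightarrow> v \<bullet> x \<le> M" by (auto simp: K_def)
    show "s *\<^sub>R v \<in> K" if "0 \<le> s" for s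
      using that M by (auto simp: K_def intro!: exI[of _ "s * M"] mult_left_mono)
    fix w assume "w \<in> K"
    then obtain M' where M': "\<And>x. x \<in> feasible a b \<Longrightarrow> w \<bullet> x \<le> M'" by (auto simp: K_def)
    show "v + w \<in> K"
      using M M' by (auto simp: K_def inner_add_left intro!: exI[of _ "M + M'"] add_mono)
  qed
  moreover have "range a \<subseteq> K"
    by (auto simp: K_def feasible_def)
  ultimately have "convex_cone hull (range a) \<subseteq> K"
    by (rule hull_minimal[rotated])
  then obtain M where "\<forall>x\<in>feasible a b. (- c) \<bullet> x \<le> M"
    using assms by (auto simp: K_def)
  then have "- M \<le> c \<bullet> x" if "x \<in> feasible a b" for x
    using that by fastforce
  then show thesis by (rule that)
qed

lemma optimal_nonempty_iff:
  fixes a :: "'m::finite \<Rightarrow> real^'n"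
  assumes "- c \<in> convex_cone hull (range a)"
  shows "optimal a c b \<noteq> {} \<longleftrightarrow> feasible a b \<noteq> {}"
proof
  assume "feasible a b \<noteq> {}"
  moreover obtain L where "\<And>x. x \<in> feasible a b \<Longrightarrow> L \<le> c \<bullet> x"
    using objective_bounded_below[OF assms] by blast
  ultimately show "optimal a c b \<noteq> {}" by (rule optimal_nonempty_if_bounded)
qed (auto simp: optimal_def)

lemma opt_value_eq:
  assumes "x \<in> optimal a c b"
  shows "opt_value a c b = c \<bullet> x"
  unfolding opt_value_def using assms
  by (intro cInf_eq_minimum) (auto simp: optimal_def)

lemma epi_feasible_eq:
  assumes "x \<in> optimal a c b"
  shows "epi_feasible a c b = {w. opt_value a c b \<le> c \<bullet> w}"
proof (intro set_eqI iffI)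
  fix w assume "w \<in> epi_feasible a c b"
  then obtain y v where "w = y + v" "y \<in> feasible a b" "0 \<le> c \<bullet> v"
    by (auto simp: epi_feasible_def polar_def elim!: set_plus_elim)
  moreover have "c \<bullet> x \<le> c \<bullet> y"
    using assms \<open>y \<in> feasible a b\<close> by (simp add: optimal_def)
  ultimately show "w \<in> {w. opt_value a c b \<le> c \<bullet> w}"
    by (simp add: opt_value_eq[OF assms] inner_add_right)
next
  fix w assume "w \<in> {w. opt_value a c b \<le> c \<bullet> w}"
  then have "w - x \<in> polar {c}"
    by (simp add: opt_value_eq[OF assms] polar_def inner_diff_right)
  then have "x + (w - x) \<in> epi_feasible a c b"
    unfolding epi_feasible_def using assms by (intro set_plus_intro) (simp_all add: optimal_def)
  then show "w \<in> epi_feasible a c b" by simp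
qed


section \<open>Lipschitz moduli of the optimal value and of the feasible set\<close>

theorem theorem9:
  fixes a :: "'m::finite \<Rightarrow> real^'n" and c :: "real^'n"
    and N :: "real^'n \<Rightarrow> real"
    and b\<^sub>0 :: "real^'m" and x\<^sub>0 :: "real^'n"
  assumes "is_norm N"
    and "- c \<in> convex_cone hull (range a)"
    and "x\<^sub>0 \<in> optimal a c b\<^sub>0"
  shows "lip (norm_metric infnorm) euclidean_metric (opt_value_map a c) b\<^sub>0 (opt_value a c b\<^sub>0)
       = lip (norm_metric infnorm) euclidean_metric (epi_value_map a c) b\<^sub>0 (opt_value a c b\<^sub>0)
     \<and> lip (norm_metric infnorm) euclidean_metric (epi_value_map a c) b\<^sub>0 (opt_value a c b\<^sub>0)
       = scale_modulus (dual_norm N c)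
           (lip (norm_metric infnorm) (norm_metric N) (epi_feasible a c) b\<^sub>0 x\<^sub>0)"
proof -
  define D where "D = {b. feasible a b \<noteq> {}}"
  define \<theta> where "\<theta> = opt_value a c"
  define \<Lambda> where "\<Lambda> = {l. lipschitz_on_nbhd infnorm D \<theta> b\<^sub>0 l}"
  have opt_iff: "optimal a c b \<noteq> {} \<longleftrightarrow> b \<in> D" for b
    unfolding D_def by (simp add: optimal_nonempty_iff[OF assms(2)])
  have b0: "b\<^sub>0 \<in> D" using assms(3) opt_iff by blast
  have x0: "c \<bullet> x\<^sub>0 = \<theta> b\<^sub>0" using opt_value_eq[OF assms(3)] by (simp add: \<theta>_def)
  have P: "opt_value_map a c = (\<lambda>b. if b \<in> D then {\<theta> b} else {})"
    by (simp add: opt_value_map_def opt_iff \<theta>_def fun_eq_iff)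
  have "{v} + {0..} = {v..}" for v :: real
    by (auto simp: set_plus_def intro: bexI[of _ "_ - v"])
  then have E: "epi_value_map a c = (\<lambda>b. if b \<in> D then {\<theta> b..} else {})"
    by (auto simp: epi_value_map_def P fun_eq_iff)
  have F: "epi_feasible a c = (\<lambda>b. if b \<in> D then {x. \<theta> b \<le> c \<bullet> x} else {})"
  proof
    fix b
    show "epi_feasible a c b = (if b \<in> D then {x. \<theta> b \<le> c \<bullet> x} else {})"
    proof (cases "b \<in> D")
      case True
      then obtain x where "x \<in> optimal a c b" using opt_iff by blast
      with True show ?thesis by (simp add: epi_feasible_eq \<theta>_def)
    next
      case False
      then show ?thesis by (simp add: D_def epi_feasible_def)
    qed
  qed
  note lip_eq = lip_eq_Inf_lipschitz_near[OF is_norm_infnorm]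
  have lip_P: "lip (norm_metric infnorm) euclidean_metric (opt_value_map a c) b\<^sub>0 (\<theta> b\<^sub>0)
      = Inf (ennreal ` \<Lambda>)"
    unfolding norm_metric_abs[symmetric] lip_eq[OF is_norm_abs] P
      lipschitz_near_singleton_iff[OF is_norm_infnorm b0] \<Lambda>_def ..
  have lip_E: "lip (norm_metric infnorm) euclidean_metric (epi_value_map a c) b\<^sub>0 (\<theta> b\<^sub>0)
      = Inf (ennreal ` \<Lambda>)"
    unfolding norm_metric_abs[symmetric] lip_eq[OF is_norm_abs] E
      lipschitz_near_atLeast_iff[OF is_norm_infnorm b0] \<Lambda>_def ..
  have lip_F: "scale_modulus (dual_norm N c)
      (lip (norm_metric infnorm) (norm_metric N) (epi_feasible a c) b\<^sub>0 x\<^sub>0) = Inf (ennreal ` \<Lambda>)"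
  proof (cases "c = 0")
    case False
    define \<delta> where "\<delta> = dual_norm N c"
    have \<delta>: "0 < \<delta>" unfolding \<delta>_def using assms(1) False by (rule dual_norm_pos)
    let ?S = "{l. lipschitz_on_nbhd infnorm D \<theta> b\<^sub>0 (\<delta> * l)}"
    have "\<Lambda> = (\<lambda>l. \<delta> * l) ` ?S"
    proof
      show "\<Lambda> \<subseteq> (\<lambda>l. \<delta> * l) ` ?S"
      proof
        fix l assume "l \<in> \<Lambda>"
        then have "l = \<delta> * (l / \<delta>)" "l / \<delta> \<in> ?S" using \<delta> by (simp_all add: \<Lambda>_def)
        then show "l \<in> (\<lambda>l. \<delta> * l) ` ?S" by blast
      qed
    qed (auto simp: \<Lambda>_def)
    moreover have "0 \<le> l" if "l \<in> ?S" for l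
      using that \<delta> by (simp add: lipschitz_on_nbhd_def zero_le_mult_iff)
    then have "scale_modulus \<delta> (Inf (ennreal ` ?S)) = Inf (ennreal ` (\<lambda>l. \<delta> * l) ` ?S)"
      by (rule scale_modulus_Inf[OF \<delta>])
    moreover have "lip (norm_metric infnorm) (norm_metric N) (epi_feasible a c) b\<^sub>0 x\<^sub>0
        = Inf (ennreal ` ?S)"
      unfolding lip_eq[OF assms(1)] F \<delta>_def
        lipschitz_near_halfspace_iff[where \<theta>=\<theta>, OF is_norm_infnorm assms(1) False b0 x0] ..
    ultimately show ?thesis by (simp add: \<delta>_def)
  next
    case True
    have \<theta>0: "\<theta> b = 0" if "b \<in> D" for b
      using that by (simp add: \<theta>_def opt_value_def D_def True)
    have F0: "epi_feasible a c = (\<lambda>b. if b \<in> D then UNIV else {})"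
      unfolding F by (rule ext) (simp add: \<theta>0 True)
    have "lipschitz_near infnorm N (epi_feasible a c) b\<^sub>0 x\<^sub>0 l
        \<longleftrightarrow> lipschitz_on_nbhd infnorm D \<theta> b\<^sub>0 l" for l
      unfolding F0 by (rule lipschitz_near_UNIV_iff[OF is_norm_infnorm assms(1) b0]) (rule \<theta>0)
    then have "lip (norm_metric infnorm) (norm_metric N) (epi_feasible a c) b\<^sub>0 x\<^sub>0
        = Inf (ennreal ` \<Lambda>)"
      by (simp add: lip_eq[OF assms(1)] \<Lambda>_def)
    moreover have "Inf (ennreal ` \<Lambda>) = \<infinity> \<or> Inf (ennreal ` \<Lambda>) = 0"
    proof (cases "\<Lambda> = {}")
      case True
      then show ?thesis by (simp add: infinity_ennreal_def)
    next
      case False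
      then obtain l r where "r > 0" "\<And>b. infnorm (b - b\<^sub>0) < r \<Longrightarrow> b \<in> D"
        unfolding \<Lambda>_def lipschitz_on_nbhd_def by blast
      then have "0 \<in> \<Lambda>"
        by (auto simp: \<Lambda>_def lipschitz_on_nbhd_def \<theta>0)
      then have "Inf (ennreal ` \<Lambda>) \<le> ennreal 0" by (rule INF_lower)
      then show ?thesis by simp
    qed
    moreover have "dual_norm N c = 0"
      using dual_norm_attained[OF assms(1), of c] True by (metis inner_zero_left)
    ultimately show ?thesis by (auto simp: scale_modulus_def)
  qed
  show ?thesis
    using lip_P lip_E lip_F by (simp add: \<theta>_def)
qed

end
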